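(* Let $G$ be an $n$-vertex graph with minimum cut value $c$, each of whose edges fails independently with probability $p$. When $p^c<n^{-4}$ (and in particular when $\mathrm{FAIL}(p)<n^{-4}$), the sum of the failure probabilities of the weak cuts of $G$ is a $(1+o(1))$-approximation to $\mathrm{FAIL}(p)$; that is, $$\sum_{C\ \text{weak cut of}\ G} p^{|C|} = (1+o(1))\,\mathrm{FAIL}(p)\qquad\text{as } n\to\infty,$$ where $|C|$ denotes the number of edges of the cut $C$.
   Context: Graphs are undirected; parallel edges are allowed; $0<p<1$. A cut is a partition of the vertex set into two nonempty groups; its edges are those with one endpoint in each group, and its value is the number of its edges. $c$ is the smallest value of any cut. A cut fails when all its edges fail, so a cut $C$ has failure probability $p^{|C|}$. $\mathrm{FAIL}(p)$ is the probability that the graph formed by the surviving edges is disconnected. An $\alpha$-minimum cut is a cut of value at most $\alpha c$. Write $p^c=n^{-(2+\delta)}$. For a target error $\epsilon$, the weak cuts of $G$ are the $\alpha$-minimum cuts with $\alpha=1+2/\delta-(\ln\epsilon)/(\delta\ln n)$. Here $\epsilon=\epsilon(n)$ is any function with $\epsilon(n)\to0$ as $n\to\infty$, and the $o(1)$ is with respect to $n\to\infty$. *)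

theory Defs
  imports "HOL-Probability.Probability" "HOL-Library.Disjoint_Sets"
begin

record ('v, 'e) mgraph =
  verts :: "'v set"
  edges :: "'e set"
  ends  :: "'e \<Rightarrow> 'v set"

text \<open>Edges are named by elements of \<^typ>\<open>'e\<close>, so parallel edges are
  distinct edges with the same set of endpoints; loops are excluded.\<close>

definition multigraph :: "('v, 'e) mgraph \<Rightarrow> bool" where
  "multigraph G \<longleftrightarrow> finite (verts G) \<and> finite (edges G) \<and>
     (\<forall>e\<in>edges G. ends G e \<subseteq> verts G \<and> card (ends G e) = 2)"

definition adjacency :: "('v, 'e) mgraph \<Rightarrow> 'v rel" where
  "adjacency G = {(u, v). \<exists>e\<in>edges G. ends G e = {u, v}}"

definition connected_graph :: "('v, 'e) mgraph \<Rightarrow> bool" where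
  "connected_graph G \<longleftrightarrow> (\<forall>u\<in>verts G. \<forall>v\<in>verts G. (u, v) \<in> (adjacency G)\<^sup>*)"

definition cuts :: "('v, 'e) mgraph \<Rightarrow> 'v set set set" where
  "cuts G = {C. partition_on (verts G) C \<and> card C = 2}"

definition cut_edges :: "('v, 'e) mgraph \<Rightarrow> 'v set set \<Rightarrow> 'e set" where
  "cut_edges G C = {e \<in> edges G. \<forall>X\<in>C. ends G e \<inter> X \<noteq> {}}"

definition cut_value :: "('v, 'e) mgraph \<Rightarrow> 'v set set \<Rightarrow> nat" where
  "cut_value G C = card (cut_edges G C)"

text \<open>Meaningful only for graphs with at least two vertices, which have a cut.\<close>

definition min_cut_value :: "('v, 'e) mgraph \<Rightarrow> nat" where
  "min_cut_value G = Min (cut_value G ` cuts G)"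

definition alpha_minimum_cuts :: "('v, 'e) mgraph \<Rightarrow> real \<Rightarrow> 'v set set set" where
  "alpha_minimum_cuts G \<alpha> =
     {C \<in> cuts G. real (cut_value G C) \<le> \<alpha> * real (min_cut_value G)}"

text \<open>In an outcome \<^term>\<open>f\<close>, edge \<^term>\<open>e\<close> fails iff \<^term>\<open>f e\<close> is true.\<close>

definition surviving_graph :: "('v, 'e) mgraph \<Rightarrow> ('e \<Rightarrow> bool) \<Rightarrow> ('v, 'e) mgraph" where
  "surviving_graph G f = G\<lparr>edges := {e \<in> edges G. \<not> f e}\<rparr>"

definition edge_failures :: "('v, 'e) mgraph \<Rightarrow> real \<Rightarrow> ('e \<Rightarrow> bool) pmf" where
  "edge_failures G p = Pi_pmf (edges G) False (\<lambda>_. bernoulli_pmf p)"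

definition FAIL :: "('v, 'e) mgraph \<Rightarrow> real \<Rightarrow> real" where
  "FAIL G p = measure_pmf.prob (edge_failures G p) {f. \<not> connected_graph (surviving_graph G f)}"

definition weak_cuts :: "('v, 'e) mgraph \<Rightarrow> real \<Rightarrow> real \<Rightarrow> 'v set set set" where
  "weak_cuts G \<delta> \<epsilon> =
     alpha_minimum_cuts G (1 + 2 / \<delta> - ln \<epsilon> / (\<delta> * ln (real (card (verts G)))))"

end

theory Submission imports Defs begin

text \<open>Let \<open>A\<close> be the sum of \<open>p ^ cut_value G C\<close> over all cuts. Then \<open>A - P \<le> FAIL G p \<le> A\<close>, where \<open>P\<close> is the
  sum over ordered pairs of distinct cuts of the probability that both fail, so it suffices that \<open>P\<close>
  and the contribution of the strong cuts are \<open>o(A)\<close>.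

  A pair of cuts is a vertex colouring with at least three of four colours; it fails when its
  bichromatic edges do. With \<open>p = exp (- t)\<close>, a sum over colourings of \<open>exp (- t * m)\<close>, \<open>m\<close> the number of
  bichromatic edges, satisfies a linear differential equation in \<open>t\<close> that relates a graph to its
  contractions. A graph on \<open>n\<close> vertices has at least \<open>n * c / 2\<close> edges, so the sum is dominated by the solution
  \<open>(1 + exp (- t * c / 2)) ^ n\<close> for independently dying vertices. For two colours this bounds the sum of
  \<open>n powr (- 2 * cut_value G C / c)\<close> over all cuts by a constant, which controls the strong cuts. For \<open>P\<close>,
  up to an error of smaller order the graph has shrunk to at most nine vertices after three quarters
  of the time, and on a graph of bounded size colourings with three colours are negligible against
  cuts.\<close>

section \<open>Colourings and contraction\<close>

text \<open>Edges carry two endpoint functions instead of a set of ends, so contraction is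
  composition with a map of vertices and leaves \<open>E\<close> unchanged. Loops may arise; they
  are never bichromatic.\<close>

definition bichromatic :: "'e set \<Rightarrow> ('e \<Rightarrow> 'v) \<Rightarrow> ('e \<Rightarrow> 'v) \<Rightarrow> ('v \<Rightarrow> 'k) \<Rightarrow> 'e set" where
  "bichromatic E a b \<sigma> = {e \<in> E. \<sigma> (a e) \<noteq> \<sigma> (b e)}"

abbreviation boundary :: "'e set \<Rightarrow> ('e \<Rightarrow> 'v) \<Rightarrow> ('e \<Rightarrow> 'v) \<Rightarrow> 'v set \<Rightarrow> 'e set" where
  "boundary E a b X \<equiv> bichromatic E a b (\<lambda>v. v \<in> X)"

text \<open>The number \<open>c\<close> is only a lower bound on cut values, a property that
  contraction preserves even when it raises the minimum. With at most one vertex the cut condition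
  is vacuous.\<close>

definition edge_connected ::
    "real \<Rightarrow> 'v set \<Rightarrow> 'e set \<Rightarrow> ('e \<Rightarrow> 'v) \<Rightarrow> ('e \<Rightarrow> 'v) \<Rightarrow> bool" where
  "edge_connected c V E a b \<longleftrightarrow> finite V \<and> finite E \<and> a ` E \<subseteq> V \<and> b ` E \<subseteq> V \<and>
     (\<forall>X. X \<subset> V \<longrightarrow> X \<noteq> {} \<longrightarrow> c \<le> real (card (boundary E a b X)))"

text \<open>Partition function of a Potts model at inverse temperature \<open>t\<close>. The weight
  depends only on the set of colours used, which is the same for a colouring of a contraction and
  for its pullback.\<close>

definition potts ::
    "('k::finite set \<Rightarrow> real) \<Rightarrow> 'v set \<Rightarrow> 'e set \<Rightarrow> ('e \<Rightarrow> 'v) \<Rightarrow> ('e \<Rightarrow> 'v) \<Rightarrow> real \<Rightarrow> real" where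
  "potts \<omega> V E a b t =
     (\<Sum>\<sigma>\<in>V \<rightarrow>\<^sub>E UNIV. \<omega> (\<sigma> ` V) * exp (- t * real (card (bichromatic E a b \<sigma>))))"

section \<open>Counting bichromatic edges\<close>

lemma finite_bichromatic [simp]: "finite E \<Longrightarrow> finite (bichromatic E a b \<sigma>)"
  by (simp add: bichromatic_def)

text \<open>Double counting: an edge is on the boundary of a colour class only if it is bichromatic
  and the class is that of one of its two ends.\<close>

lemma sum_colour_boundaries_le:
  assumes "finite V" "finite E"
  shows "(\<Sum>k\<in>\<sigma> ` V. card (boundary E a b (\<sigma> -` {k}))) \<le> 2 * card (bichromatic E a b \<sigma>)"
proof -
  have "(\<Sum>k\<in>\<sigma> ` V. card (boundary E a b (\<sigma> -` {k})))
      = (\<Sum>k\<in>\<sigma> ` V. \<Sum>e\<in>bichromatic E a b \<sigma>. if k = \<sigma> (a e) \<or> k = \<sigma> (b e) then 1 else 0)"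
  proof (rule sum.cong [OF refl])
    fix k
    have "boundary E a b (\<sigma> -` {k}) = {e \<in> bichromatic E a b \<sigma>. k = \<sigma> (a e) \<or> k = \<sigma> (b e)}"
      by (auto simp: bichromatic_def)
    then show "card (boundary E a b (\<sigma> -` {k}))
        = (\<Sum>e\<in>bichromatic E a b \<sigma>. if k = \<sigma> (a e) \<or> k = \<sigma> (b e) then 1 else 0)"
      using assms by (simp add: sum.If_cases Int_def)
  qed
  also have "\<dots> = (\<Sum>e\<in>bichromatic E a b \<sigma>. \<Sum>k\<in>\<sigma> ` V. if k = \<sigma> (a e) \<or> k = \<sigma> (b e) then 1 else 0)"
    by (rule sum.swap)
  also have "\<dots> \<le> (\<Sum>e\<in>bichromatic E a b \<sigma>. 2)"
  proof (rule sum_mono)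
    fix e
    have "(\<Sum>k\<in>\<sigma> ` V. if k = \<sigma> (a e) \<or> k = \<sigma> (b e) then 1 else 0)
        = card (\<sigma> ` V \<inter> {k. k = \<sigma> (a e) \<or> k = \<sigma> (b e)})"
      using assms by (simp add: sum.If_cases)
    also have "\<dots> \<le> card {\<sigma> (a e), \<sigma> (b e)}"
      by (intro card_mono) auto
    also have "\<dots> \<le> 2"
      by (simp add: card_insert_if)
    finally show "(\<Sum>k\<in>\<sigma> ` V. if k = \<sigma> (a e) \<or> k = \<sigma> (b e) then 1 else 0) \<le> (2::nat)" .
  qed
  finally show ?thesis by simp
qed

lemma boundary_Int:
  assumes "a ` E \<subseteq> V" "b ` E \<subseteq> V"
  shows "boundary E a b (X \<inter> V) = boundary E a b X"
  using assms by (auto simp: bichromatic_def)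

lemma edge_connectedD:
  assumes "edge_connected c V E a b"
  shows "finite V" "finite E" "a ` E \<subseteq> V" "b ` E \<subseteq> V"
    and "\<And>X. X \<subset> V \<Longrightarrow> X \<noteq> {} \<Longrightarrow> c \<le> card (boundary E a b X)"
proof -
  note * = assms [unfolded edge_connected_def]
  show "finite V" "finite E" "a ` E \<subseteq> V" "b ` E \<subseteq> V"
    using * by blast+
  show "c \<le> card (boundary E a b X)" if "X \<subset> V" "X \<noteq> {}" for X
    using * [THEN conjunct2, THEN conjunct2, THEN conjunct2, THEN conjunct2, rule_format, OF that] .
qed

lemma edge_connected_colour_boundary:
  assumes "edge_connected c V E a b" "2 \<le> card (\<sigma> ` V)" "k \<in> \<sigma> ` V"
  shows "c \<le> card (boundary E a b (\<sigma> -` {k}))"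
proof -
  have "\<not> \<sigma> ` V \<subseteq> {k}"
    using card_mono [of "{k}" "\<sigma> ` V"] assms(2) by auto
  then obtain v where "v \<in> V" "\<sigma> v \<noteq> k" by blast
  then have "\<sigma> -` {k} \<inter> V \<subset> V" by blast
  moreover have "\<sigma> -` {k} \<inter> V \<noteq> {}" using assms(3) by auto
  ultimately have "c \<le> card (boundary E a b (\<sigma> -` {k} \<inter> V))"
    by (rule edge_connectedD [OF assms(1)])
  moreover have "boundary E a b (\<sigma> -` {k} \<inter> V) = boundary E a b (\<sigma> -` {k})"
    by (rule boundary_Int [OF edge_connectedD(3,4) [OF assms(1)]])
  ultimately show ?thesis by simp
qed

text \<open>Every class has a boundary of at least \<open>c\<close> edges, and each edge is counted
  at most twice. For the identity colouring this says that n \<ge> 2 vertices force at least n * c /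
  2 edges that are not loops.\<close>

lemma edge_connected_card_bichromatic:
  assumes "edge_connected c V E a b" "2 \<le> card (\<sigma> ` V)"
  shows "real (card (\<sigma> ` V)) * c \<le> 2 * real (card (bichromatic E a b \<sigma>))"
proof -
  have fin: "finite V" "finite E" using edge_connectedD(1,2) [OF assms(1)] .
  have "real (card (\<sigma> ` V)) * c \<le> (\<Sum>k\<in>\<sigma> ` V. real (card (boundary E a b (\<sigma> -` {k}))))"
    by (intro sum_bounded_below edge_connected_colour_boundary [OF assms])
  also have "\<dots> = real (\<Sum>k\<in>\<sigma> ` V. card (boundary E a b (\<sigma> -` {k})))"
    by simp
  also have "\<dots> \<le> real (2 * card (bichromatic E a b \<sigma>))"
    using sum_colour_boundaries_le [OF fin, where \<sigma> = \<sigma> and a = a and b = b] by linarith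
  finally show ?thesis by simp
qed

section \<open>Contraction and the comparison principle\<close>

text \<open>A cut of the contracted graph pulls back along the contraction map to a cut of the
  original graph with the same edges.\<close>

lemma edge_connected_contract:
  assumes "edge_connected c V E a b" "x \<in> V" "y \<in> V" "x \<noteq> y"
  shows "edge_connected c (V - {y}) E (id(y := x) \<circ> a) (id(y := x) \<circ> b)"
proof -
  let ?\<phi> = "id(y := x)"
  have ends: "(?\<phi> \<circ> a) ` E \<subseteq> V - {y}" "(?\<phi> \<circ> b) ` E \<subseteq> V - {y}"
    using edge_connectedD(3,4) [OF assms(1)] assms(2-4) by auto
  have cut: "c \<le> card (boundary E (?\<phi> \<circ> a) (?\<phi> \<circ> b) X)"
    if X: "X \<subset> V - {y}" "X \<noteq> {}" for X
  proof -
    let ?Y = "?\<phi> -` X \<inter> V"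
    obtain v where v: "v \<in> V - {y}" "v \<notin> X" using X(1) by blast
    then have "v \<in> V" "v \<notin> ?Y" by auto
    then have "?Y \<subset> V" by blast
    moreover obtain u where "u \<in> X" "u \<in> V" "u \<noteq> y" using X by blast
    then have "u \<in> ?Y" by simp
    then have "?Y \<noteq> {}" by blast
    ultimately have "c \<le> card (boundary E a b ?Y)"
      by (rule edge_connectedD [OF assms(1)])
    also have "boundary E a b ?Y = boundary E a b (?\<phi> -` X)"
      by (rule boundary_Int [OF edge_connectedD(3,4) [OF assms(1)]])
    also have "\<dots> = boundary E (?\<phi> \<circ> a) (?\<phi> \<circ> b) X"
      by (simp add: bichromatic_def)
    finally show ?thesis .
  qed
  have "finite (V - {y})" "finite E"
    using edge_connectedD(1,2) [OF assms(1)] by simp_all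
  then show ?thesis
    unfolding edge_connected_def by (intro conjI allI impI ends cut)
qed

text \<open>The bijection copies the colour of \<open>x\<close> to \<open>y\<close>; its inverse
  forgets the colour of \<open>y\<close>. Neither changes the image or the set of bichromatic
  edges.\<close>

lemma potts_contract:
  assumes "finite V" "a ` E \<subseteq> V" "b ` E \<subseteq> V" "x \<in> V" "y \<in> V" "x \<noteq> y"
  shows "potts \<omega> (V - {y}) E (id(y := x) \<circ> a) (id(y := x) \<circ> b) t =
    (\<Sum>\<sigma>\<in>{\<sigma> \<in> V \<rightarrow>\<^sub>E UNIV. \<sigma> x = \<sigma> y}. \<omega> (\<sigma> ` V) * exp (- t * real (card (bichromatic E a b \<sigma>))))"
  unfolding potts_def
proof (rule sum.reindex_bij_witness
    [where i = "\<lambda>\<sigma>. restrict \<sigma> (V - {y})" and j = "\<lambda>\<sigma>. \<sigma>(y := \<sigma> x)"], goal_cases)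
  case (1 \<sigma>)
  then have "\<sigma> v = undefined" if "v \<notin> V - {y}" for v
    using that by (rule PiE_arb)
  then show ?case by (intro ext) (simp add: restrict_def)
next
  case (2 \<sigma>)
  then have "\<sigma> v = undefined" if "v \<notin> V" for v
    using that PiE_arb [of \<sigma> "V - {y}" "\<lambda>_. UNIV" v] by simp
  then show ?case using assms(5,6) by (simp add: PiE_iff extensional_def)
next
  case (3 \<sigma>)
  then have "\<sigma> v = undefined" if "v \<notin> V" for v
    using that PiE_arb by fastforce
  then show ?case using 3 assms(4,6) by (intro ext) (auto simp: restrict_def)
next
  case (4 \<sigma>)
  show ?case by (rule restrict_PiE_iff [THEN iffD2]) simp
next
  case (5 \<sigma>)
  have eq: "(\<sigma>(y := \<sigma> x)) v = \<sigma> ((id(y := x)) v)" for v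
    using assms by simp
  have "V \<inter> {v. v \<noteq> y} = V - {y}" by auto
  then have "(\<sigma>(y := \<sigma> x)) ` V = \<sigma> ` (V - {y})"
    using assms by (simp add: fun_upd_image insert_absorb)
  moreover have "bichromatic E a b (\<sigma>(y := \<sigma> x)) = bichromatic E (id(y := x) \<circ> a) (id(y := x) \<circ> b) \<sigma>"
    unfolding bichromatic_def eq by simp
  ultimately show ?case by (simp only:)
qed

text \<open>Contracting the edge \<open>e\<close> keeps exactly the colourings that are constant on \<open>e\<close>, so a
  colouring with \<open>m\<close> bichromatic edges survives \<open>card N - m\<close> of the contractions.\<close>

lemma potts_ode:
  fixes \<omega> :: "'k::finite set \<Rightarrow> real"
  assumes "edge_connected c V E a b"
  defines "N \<equiv> {e \<in> E. a e \<noteq> b e}"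
  shows "(potts \<omega> V E a b has_real_derivative
    (\<Sum>e\<in>N. potts \<omega> (V - {b e}) E (id(b e := a e) \<circ> a) (id(b e := a e) \<circ> b) t)
      - real (card N) * potts \<omega> V E a b t) (at t)"
proof -
  let ?m = "\<lambda>\<sigma>::'a \<Rightarrow> 'k. real (card (bichromatic E a b \<sigma>))"
  let ?f = "\<lambda>\<sigma>. \<omega> (\<sigma> ` V) * exp (- t * ?m \<sigma>)"
  have fin: "finite V" "finite E" "finite N" "a ` E \<subseteq> V" "b ` E \<subseteq> V"
    using edge_connectedD(1-4) [OF assms(1)] by (auto simp: N_def)
  have finP: "finite (V \<rightarrow>\<^sub>E (UNIV :: 'k set))" using fin by (simp add: finite_PiE)
  have "(potts \<omega> V E a b has_real_derivative (\<Sum>\<sigma>\<in>V \<rightarrow>\<^sub>E UNIV. - ?m \<sigma> * ?f \<sigma>)) (at t)"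
    unfolding potts_def [abs_def]
    by (auto intro!: derivative_eq_intros sum.cong)
  moreover have "(\<Sum>e\<in>N. potts \<omega> (V - {b e}) E (id(b e := a e) \<circ> a) (id(b e := a e) \<circ> b) t)
      = (\<Sum>\<sigma>\<in>V \<rightarrow>\<^sub>E UNIV. (real (card N) - ?m \<sigma>) * ?f \<sigma>)"
  proof -
    have "(\<Sum>e\<in>N. potts \<omega> (V - {b e}) E (id(b e := a e) \<circ> a) (id(b e := a e) \<circ> b) t)
      = (\<Sum>e\<in>N. \<Sum>\<sigma>\<in>{\<sigma> \<in> V \<rightarrow>\<^sub>E UNIV. \<sigma> (a e) = \<sigma> (b e)}. ?f \<sigma>)"
      by (intro sum.cong refl potts_contract) (use fin in \<open>auto simp: N_def\<close>)
    also have "\<dots> = (\<Sum>\<sigma>\<in>V \<rightarrow>\<^sub>E UNIV. \<Sum>e\<in>{e \<in> N. \<sigma> (a e) = \<sigma> (b e)}. ?f \<sigma>)"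
      by (rule sum.swap_restrict) (use fin finP in auto)
    also have "\<dots> = (\<Sum>\<sigma>\<in>V \<rightarrow>\<^sub>E UNIV. (real (card N) - ?m \<sigma>) * ?f \<sigma>)"
    proof (rule sum.cong [OF refl])
      fix \<sigma> :: "'a \<Rightarrow> 'k"
      have "{e \<in> N. \<sigma> (a e) = \<sigma> (b e)} = N - bichromatic E a b \<sigma>"
        by (auto simp: N_def bichromatic_def)
      moreover have "bichromatic E a b \<sigma> \<subseteq> N"
        by (auto simp: N_def bichromatic_def)
      ultimately show "(\<Sum>e\<in>{e \<in> N. \<sigma> (a e) = \<sigma> (b e)}. ?f \<sigma>) = (real (card N) - ?m \<sigma>) * ?f \<sigma>"
        using fin by (simp add: card_Diff_subset of_nat_diff card_mono finite_subset)
    qed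
    finally show ?thesis .
  qed
  moreover have "(\<Sum>\<sigma>\<in>V \<rightarrow>\<^sub>E UNIV. (real (card N) - ?m \<sigma>) * ?f \<sigma>) - real (card N) * potts \<omega> V E a b t
      = (\<Sum>\<sigma>\<in>V \<rightarrow>\<^sub>E UNIV. - ?m \<sigma> * ?f \<sigma>)"
    unfolding potts_def sum_distrib_left sum_subtractf [symmetric]
    by (intro sum.cong refl) (simp add: algebra_simps)
  ultimately show ?thesis by simp
qed

text \<open>Induction on the number of vertices: a contraction has one vertex less, so its sum is
  already bounded and the differential equation becomes an inequality. Graphs with at most
  \<open>R\<close> vertices are the base case; as \<open>1 \<le> R\<close>, all others have the two
  vertices that the edge count requires. Weights of either sign are allowed, so the bound applies to
  differences of sums.\<close>

lemma potts_comparison: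
  fixes \<omega> :: "'k::finite set \<Rightarrow> real" and E :: "'e set"
  assumes c: "0 \<le> c" and \<alpha>: "0 \<le> \<alpha>" and \<beta>: "0 \<le> \<beta>" and R: "1 \<le> R" and t: "t\<^sub>0 \<le> t"
    and initial: "\<And>(V::'v set) a b. edge_connected c V E a b \<Longrightarrow> R < card V \<Longrightarrow>
      potts \<omega> V E a b t\<^sub>0 \<le> \<alpha> * (1 + \<beta>) ^ card V"
    and small: "\<And>(V::'v set) a b t. edge_connected c V E a b \<Longrightarrow> card V \<le> R \<Longrightarrow> t\<^sub>0 \<le> t \<Longrightarrow>
      potts \<omega> V E a b t \<le> \<alpha> * (1 + \<beta> * exp (- (t - t\<^sub>0) * c / 2)) ^ card V"
    and G: "edge_connected c (V::'v set) E a b"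
  shows "potts \<omega> V E a b t \<le> \<alpha> * (1 + \<beta> * exp (- (t - t\<^sub>0) * c / 2)) ^ card V"
proof -
  define B where "B n t = \<alpha> * (1 + \<beta> * exp (- (t - t\<^sub>0) * c / 2)) ^ n" for n t
  have "potts \<omega> V E a b t \<le> B (card V) t" using G t
  proof (induction "card V" arbitrary: V a b t)
    case 0
    then show ?case using small [OF 0(2) _ 0(3)] R by (simp add: B_def)
  next
    case (Suc n)
    show ?case
    proof (cases "card V \<le> R")
      case True
      then show ?thesis using small [OF Suc.prems(1) _ Suc.prems(2)] by (simp add: B_def)
    next
      case False
      then have n: "1 \<le> n" "card V = Suc n" using R Suc.hyps by auto
      define N where "N = {e \<in> E. a e \<noteq> b e}"
      let ?M = "real (card N)"
      let ?\<Phi> = "potts \<omega> V E a b"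
      let ?D = "\<lambda>s. \<Sum>e\<in>N. potts \<omega> (V - {b e}) E (id(b e := a e) \<circ> a) (id(b e := a e) \<circ> b) s"
      let ?x = "\<lambda>s. 1 + \<beta> * exp (- (s - t\<^sub>0) * c / 2)"
      have V: "finite V" "a ` E \<subseteq> V" "b ` E \<subseteq> V"
        using edge_connectedD(1,3,4) [OF Suc.prems(1)] .
      \<comment> \<open>The bichromatic edges of the identity colouring are the non-loops
        \<open>N\<close>.\<close>
      have M: "Suc n * c / 2 \<le> ?M"
        using edge_connected_card_bichromatic [OF Suc.prems(1), of id] n
        by (simp add: bichromatic_def N_def)
      have D: "?D s \<le> ?M * B n s" if "t\<^sub>0 \<le> s" for s
      proof (rule sum_bounded_above)
        fix e assume "e \<in> N"
        then have e: "e \<in> E" "a e \<noteq> b e" by (auto simp: N_def)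
        with V have ab: "a e \<in> V" "b e \<in> V" by auto
        then have card: "card (V - {b e}) = n" using n V by simp
        have "edge_connected c (V - {b e}) E (id(b e := a e) \<circ> a) (id(b e := a e) \<circ> b)"
          by (rule edge_connected_contract [OF Suc.prems(1) ab e(2)])
        from Suc.hyps(1) [OF card [symmetric] this that] show
          "potts \<omega> (V - {b e}) E (id(b e := a e) \<circ> a) (id(b e := a e) \<circ> b) s \<le> B n s"
          by (simp add: card)
      qed
      \<comment> \<open>\<open>B\<close> solves exactly the equation with edge rate
        \<open>Suc n * c / 2\<close> in which every contraction contributes
        \<open>B n\<close>.\<close>
      have B': "(B (Suc n) has_real_derivative - (Suc n * c / 2) * (B (Suc n) s - B n s)) (at s)" for s
      proof -
        have "((\<lambda>s. \<alpha> * ?x s ^ Suc n) has_real_derivative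
            \<alpha> * (real (Suc n) * (\<beta> * (exp (- (s - t\<^sub>0) * c / 2) * (- c / 2))) * ?x s ^ n)) (at s)"
          by (rule derivative_eq_intros refl | simp)+
        then show ?thesis
          unfolding B_def [abs_def] by (rule DERIV_cong) (simp add: algebra_simps)
      qed
      \<comment> \<open>The integrating factor cancels the term linear in \<open>?\<Phi>\<close>, so
        the sign of the derivative needs only an upper bound on \<open>?D\<close>.\<close>
      let ?h = "\<lambda>s. exp (?M * s) * (B (Suc n) s - ?\<Phi> s)"
      let ?h' = "\<lambda>s. exp (?M * s) * (?M * B (Suc n) s - (Suc n * c / 2) * (B (Suc n) s - B n s) - ?D s)"
      have "?h t\<^sub>0 \<le> ?h t"
      proof (rule DERIV_nonneg_imp_nondecreasing [OF Suc.prems(2)])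
        fix s assume s: "t\<^sub>0 \<le> s" "s \<le> t"
        have "(?h has_real_derivative ?h' s) (at s)"
        proof -
          have "((\<lambda>s. exp (?M * s)) has_real_derivative ?M * exp (?M * s)) (at s)"
            by (auto intro!: derivative_eq_intros)
          from DERIV_mult [OF this DERIV_diff [OF B' potts_ode [OF Suc.prems(1), folded N_def]]]
          show ?thesis by (rule DERIV_cong) (simp add: algebra_simps)
        qed
        moreover have "0 \<le> ?h' s"
        proof -
          \<comment> \<open>Edges in excess of \<open>Suc n * c / 2\<close> only help, because a
            contraction lowers the bound.\<close>
          have "B n s \<le> B (Suc n) s"
            unfolding B_def using \<alpha> \<beta> by (intro mult_left_mono power_increasing) auto
          then have "0 \<le> (?M - Suc n * c / 2) * (B (Suc n) s - B n s)"
            using M by (intro mult_nonneg_nonneg) auto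
          also have "\<dots> = ?M * B (Suc n) s - (Suc n * c / 2) * (B (Suc n) s - B n s) - ?M * B n s"
            by (simp add: algebra_simps)
          also have "\<dots> \<le> ?M * B (Suc n) s - (Suc n * c / 2) * (B (Suc n) s - B n s) - ?D s"
            using D [OF s(1)] by simp
          finally show ?thesis by simp
        qed
        ultimately show "\<exists>y. (?h has_real_derivative y) (at s) \<and> 0 \<le> y" by blast
      qed
      moreover have "0 \<le> ?h t\<^sub>0"
        using initial [OF Suc.prems(1)] False n by (simp add: B_def)
      ultimately have "0 \<le> ?h t" by linarith
      then show ?thesis using n by (simp add: zero_le_mult_iff)
    qed
  qed
  then show ?thesis by (simp add: B_def)
qed

section \<open>Colourings with two and with three colours\<close>

lemma potts_diff_mult:
  "potts (\<lambda>I. f I - l * g I) V E a b t = potts f V E a b t - l * potts g V E a b t"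
  by (simp add: potts_def sum_subtractf sum_distrib_left algebra_simps)

lemma potts_indicator:
  assumes "finite V"
  shows "potts (\<lambda>I. if P I then 1 else 0) V E a b t =
    (\<Sum>\<sigma>\<in>{\<sigma> \<in> V \<rightarrow>\<^sub>E UNIV. P (\<sigma> ` V)}. exp (- t * real (card (bichromatic E a b \<sigma>))))"
proof -
  have "potts (\<lambda>I. if P I then 1 else 0) V E a b t =
      (\<Sum>\<sigma>\<in>V \<rightarrow>\<^sub>E UNIV. if P (\<sigma> ` V) then exp (- t * real (card (bichromatic E a b \<sigma>))) else 0)"
    unfolding potts_def by (intro sum.cong) auto
  also have "\<dots> = (\<Sum>\<sigma>\<in>{\<sigma> \<in> V \<rightarrow>\<^sub>E UNIV. P (\<sigma> ` V)}. exp (- t * real (card (bichromatic E a b \<sigma>))))"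
    by (rule sum.inter_filter [symmetric]) (simp add: assms finite_PiE)
  finally show ?thesis .
qed

lemma potts_le_card:
  fixes \<omega> :: "'k::finite set \<Rightarrow> real"
  assumes "finite V" "\<And>I. \<omega> I \<le> 1" "0 \<le> t"
  shows "potts \<omega> V E a b t \<le> real CARD('k) ^ card V"
proof -
  have "potts \<omega> V E a b t \<le> real (card (V \<rightarrow>\<^sub>E (UNIV :: 'k set))) * 1"
    unfolding potts_def
  proof (rule sum_bounded_above)
    fix \<sigma> :: "'a \<Rightarrow> 'k"
    let ?x = "exp (- t * real (card (bichromatic E a b \<sigma>)))"
    have "\<omega> (\<sigma> ` V) * ?x \<le> 1 * ?x" by (intro mult_right_mono assms) simp
    also have "\<dots> \<le> 1" using assms(3) by simp
    finally show "\<omega> (\<sigma> ` V) * ?x \<le> 1" .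
  qed
  then show ?thesis using assms(1) by (simp add: card_funcsetE)
qed

text \<open>A colouring with image \<open>{x, y}\<close> is determined by its class of colour
  \<open>x\<close>, a proper nonempty vertex set. Each cut therefore enters once for each of its
  sides.\<close>

lemma potts_two_colours:
  fixes x y :: "'k::finite"
  assumes "finite V" "a ` E \<subseteq> V" "b ` E \<subseteq> V" "x \<noteq> y"
  shows "potts (\<lambda>I. if I = {x, y} then 1 else 0) V E a b t =
    (\<Sum>X\<in>{X. X \<subset> V \<and> X \<noteq> {}}. exp (- t * real (card (boundary E a b X))))"
  unfolding potts_indicator [OF assms(1)]
proof (rule sum.reindex_bij_witness
    [where i = "\<lambda>X. \<lambda>v\<in>V. if v \<in> X then x else y" and j = "\<lambda>\<sigma>. {v \<in> V. \<sigma> v = x}"], goal_cases)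
  case (1 \<sigma>)
  then have "\<sigma> v = undefined" if "v \<notin> V" for v
    using that PiE_arb [of \<sigma> V "\<lambda>_. UNIV" v] by simp
  moreover have "\<sigma> v = y" if "v \<in> V" "\<sigma> v \<noteq> x" for v
    using 1 that by auto
  ultimately show ?case by (intro ext) (simp add: restrict_def)
next
  case (2 \<sigma>)
  then have "x \<in> \<sigma> ` V" "y \<in> \<sigma> ` V" by auto
  then obtain u v where "u \<in> V" "\<sigma> u = x" "v \<in> V" "\<sigma> v = y" by blast
  then have "u \<in> {v \<in> V. \<sigma> v = x}" "v \<in> V - {v \<in> V. \<sigma> v = x}" using assms(4) by simp_all
  then show ?case by blast
next
  case (3 X)
  then show ?case using assms(4) by auto
next
  case (4 X)
  then obtain u v where "u \<in> X" "u \<in> V" "v \<in> V" "v \<notin> X" by blast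
  then have "(\<lambda>v\<in>V. if v \<in> X then x else y) ` V = {x, y}"
    by (auto simp: image_iff)
  then show ?case by simp
next
  case (5 \<sigma>)
  then have *: "\<sigma> v = x \<or> \<sigma> v = y" if "v \<in> V" for v using that by auto
  have "boundary E a b {v \<in> V. \<sigma> v = x} = bichromatic E a b \<sigma>"
    unfolding bichromatic_def
  proof (intro Collect_cong conj_cong refl)
    fix e assume "e \<in> E"
    then have "a e \<in> V" "b e \<in> V" using assms(2,3) by auto
    then show "((a e \<in> {v \<in> V. \<sigma> v = x}) \<noteq> (b e \<in> {v \<in> V. \<sigma> v = x})) = (\<sigma> (a e) \<noteq> \<sigma> (b e))"
      using *[of "a e"] *[of "b e"] assms(4) by auto
  qed
  then show ?case by simp
qed

text \<open>Comparison from time 0: there are at most \<open>2 ^ card V\<close> colourings then, and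
  a single vertex cannot carry two colours. When \<open>exp (- t * c / 2) = 1 / card V\<close> the
  bound is at most e, a weighted form of the fact that few cuts are near minimum.\<close>

lemma sum_cut_weights_le:
  assumes G: "edge_connected c V E a b" and "0 \<le> c" "0 \<le> t"
  shows "(\<Sum>X\<in>{X. X \<subset> V \<and> X \<noteq> {}}. exp (- t * real (card (boundary E a b X))))
    \<le> (1 + exp (- t * c / 2)) ^ card V"
proof -
  let ?\<omega> = "\<lambda>I :: bool set. if I = {True, False} then 1 else 0 :: real"
  have "potts ?\<omega> V E a b t \<le> 1 * (1 + 1 * exp (- (t - 0) * c / 2)) ^ card V"
  proof (rule potts_comparison [where R = 1])
    fix V :: "'a set" and a b :: "'b \<Rightarrow> 'a"
    assume G: "edge_connected c V E a b"
    show "potts ?\<omega> V E a b 0 \<le> 1 * (1 + 1) ^ card V"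
      using potts_le_card [OF edge_connectedD(1) [OF G], of ?\<omega> 0 E a b] by simp
  next
    fix V :: "'a set" and a b :: "'b \<Rightarrow> 'a" and t :: real
    assume G: "edge_connected c V E a b" and V: "card V \<le> 1"
    have "\<sigma> ` V \<noteq> {True, False}" for \<sigma>
    proof
      assume "\<sigma> ` V = {True, False}"
      then have "card {True, False} \<le> card V"
        using card_image_le [OF edge_connectedD(1) [OF G], of \<sigma>] by simp
      with V show False by simp
    qed
    then have "potts ?\<omega> V E a b t = 0" by (simp add: potts_def)
    then show "potts ?\<omega> V E a b t \<le> 1 * (1 + 1 * exp (- (t - 0) * c / 2)) ^ card V"
      by simp
  qed (use assms in auto)
  moreover have "potts ?\<omega> V E a b t =
      (\<Sum>X\<in>{X. X \<subset> V \<and> X \<noteq> {}}. exp (- t * real (card (boundary E a b X))))"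
    by (rule potts_two_colours [OF edge_connectedD(1,3,4) [OF G]]) simp
  ultimately show ?thesis by simp
qed

text \<open>The smallest of at least three colour classes carries at most two thirds of the
  bichromatic edges, so replacing the colouring by that class saves at least \<open>c / 2\<close> edges.\<close>

lemma potts_three_colours_le:
  fixes x y :: "'k::finite"
  assumes G: "edge_connected c V E a b" and t: "0 \<le> t" and xy: "x \<noteq> y"
  shows "potts (\<lambda>I::'k set. if 3 \<le> card I then 1 else 0) V E a b t
    \<le> real CARD('k) ^ card V * (exp (- t * c / 2) * potts (\<lambda>I. if I = {x, y} then 1 else 0) V E a b t)"
    (is "_ \<le> _ * (_ * ?T)")
proof -
  let ?S = "{\<sigma> \<in> V \<rightarrow>\<^sub>E (UNIV :: 'k set). 3 \<le> card (\<sigma> ` V)}"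
  note fin = edge_connectedD(1,2) [OF G]
  have T: "?T = (\<Sum>X\<in>{X. X \<subset> V \<and> X \<noteq> {}}. exp (- t * real (card (boundary E a b X))))"
    by (rule potts_two_colours [OF edge_connectedD(1,3,4) [OF G] xy])
  have "0 \<le> ?T" unfolding T by (intro sum_nonneg) simp
  have finS: "finite (V \<rightarrow>\<^sub>E (UNIV :: 'k set))" using fin by (simp add: finite_PiE)
  have "potts (\<lambda>I::'k set. if 3 \<le> card I then 1 else 0) V E a b t
      = (\<Sum>\<sigma>\<in>?S. exp (- t * real (card (bichromatic E a b \<sigma>))))"
    by (rule potts_indicator [OF fin(1)])
  \<comment> \<open>Each colouring is charged to the whole two-colour sum; the resulting factor, the
    number of colourings, is harmless for boundedly many vertices.\<close>
  also have "\<dots> \<le> real (card ?S) * (exp (- t * c / 2) * ?T)"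
  proof (rule sum_bounded_above)
    fix \<sigma> assume "\<sigma> \<in> ?S"
    then have card3: "3 \<le> card (\<sigma> ` V)" by simp
    let ?d = "\<lambda>k. card (boundary E a b (\<sigma> -` {k}))"
    have ne: "finite (\<sigma> ` V)" "\<sigma> ` V \<noteq> {}" using card3 fin by auto
    obtain k where k: "k \<in> \<sigma> ` V" and min: "\<And>l. l \<in> \<sigma> ` V \<Longrightarrow> ?d k \<le> ?d l"
      using arg_min_if_finite [OF ne, of ?d] by (metis linorder_not_le)
    have "3 * ?d k \<le> card (\<sigma> ` V) * ?d k" using card3 by (rule mult_right_mono) simp
    also have "\<dots> \<le> (\<Sum>l\<in>\<sigma> ` V. ?d l)"
      using sum_bounded_below [of "\<sigma> ` V" "?d k" ?d] min by simp
    also have "\<dots> \<le> 2 * card (bichromatic E a b \<sigma>)"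
      by (rule sum_colour_boundaries_le [OF fin])
    finally have "3 * real (?d k) \<le> 2 * real (card (bichromatic E a b \<sigma>))" by linarith
    moreover have "c \<le> ?d k"
      by (rule edge_connected_colour_boundary [OF G _ k]) (use card3 in simp)
    ultimately have "c / 2 + real (?d k) \<le> real (card (bichromatic E a b \<sigma>))" by linarith
    then have "t * (c / 2 + real (?d k)) \<le> t * real (card (bichromatic E a b \<sigma>))"
      using t by (rule mult_left_mono)
    then have "exp (- t * real (card (bichromatic E a b \<sigma>))) \<le> exp (- t * c / 2 + - t * real (?d k))"
      by (simp add: algebra_simps)
    also have "\<dots> = exp (- t * c / 2) * exp (- t * real (?d k))"
      by (rule exp_add)
    also have "exp (- t * real (?d k)) \<le> ?T"
    proof -
      let ?X = "\<sigma> -` {k} \<inter> V"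
      have "\<not> \<sigma> ` V \<subseteq> {k}"
        using card_mono [of "{k}" "\<sigma> ` V"] card3 by auto
      then obtain v where "v \<in> V" "\<sigma> v \<noteq> k" by blast
      then have "?X \<subset> V" by blast
      moreover have "?X \<noteq> {}" using k by auto
      moreover have "boundary E a b ?X = boundary E a b (\<sigma> -` {k})"
        by (rule boundary_Int [OF edge_connectedD(3,4) [OF G]])
      moreover have "finite {X. X \<subset> V \<and> X \<noteq> {}}"
        by (rule finite_subset [of _ "Pow V"]) (use fin in auto)
      ultimately show ?thesis unfolding T
        using member_le_sum [of ?X "{X. X \<subset> V \<and> X \<noteq> {}}"
            "\<lambda>X. exp (- t * real (card (boundary E a b X)))"] by simp
    qed
    finally show "exp (- t * real (card (bichromatic E a b \<sigma>))) \<le> exp (- t * c / 2) * ?T"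
      by simp
  qed
  also have "\<dots> \<le> real (card (V \<rightarrow>\<^sub>E (UNIV :: 'k set))) * (exp (- t * c / 2) * ?T)"
    using \<open>0 \<le> ?T\<close> finS by (intro mult_right_mono of_nat_mono card_mono) auto
  also have "\<dots> = real CARD('k) ^ card V * (exp (- t * c / 2) * ?T)"
    using fin by (simp add: card_funcsetE)
  finally show ?thesis .
qed

text \<open>The comparison starts at time \<open>t / 4\<close>: for at most \<open>R\<close> vertices the previous lemma makes the weighted
  difference nonpositive from then on, and \<open>s ^ R * (\<dots> / s) ^ n\<close> exceeds the number of colourings when \<open>n > R\<close>.\<close>

lemma potts_three_colours_comparison:
  fixes x y :: "'k::finite"
  assumes G: "edge_connected c V E a b" and c: "0 \<le> c" and t: "0 \<le> t" and xy: "x \<noteq> y"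
    and R: "1 \<le> R"
  defines "s \<equiv> exp (- t * c / 8)"
  shows "potts (\<lambda>I::'k set. if 3 \<le> card I then 1 else 0) V E a b t
    \<le> real CARD('k) ^ R * s * potts (\<lambda>I. if I = {x, y} then 1 else 0) V E a b t
      + s ^ R * (1 + real CARD('k) * s\<^sup>2) ^ card V"
proof -
  let ?K = "real CARD('k)"
  let ?three = "\<lambda>I :: 'k set. if 3 \<le> card I then 1 else 0 :: real"
  let ?two = "\<lambda>I. if I = {x, y} then 1 else 0 :: real"
  let ?\<omega> = "\<lambda>I. ?three I - ?K ^ R * s * ?two I"
  have s: "0 < s" "s \<le> 1" using c t by (auto simp: s_def)
  have K: "1 \<le> ?K" by (simp add: Suc_leI)
  have two_nonneg: "0 \<le> potts ?two V E a b t" for V :: "'a set" and a b :: "'b \<Rightarrow> 'a" and t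
    unfolding potts_def by (intro sum_nonneg) simp
  \<comment> \<open>With this choice the bound starts at \<open>s ^ R * (?K / s) ^ n\<close>, and
    the decay by \<open>s ^ 3\<close> over the remaining three quarters of the time leaves at most
    \<open>?K * s ^ 2\<close> in place of \<open>?K / s\<close>.\<close>
  have \<beta>: "0 \<le> ?K / s - 1" using s K order_trans [of s 1 ?K] by (simp add: field_simps)
  have "potts ?\<omega> V E a b t \<le> s ^ R * (1 + (?K / s - 1) * exp (- (t - t / 4) * c / 2)) ^ card V"
  proof (rule potts_comparison [OF c _ \<beta> R _ _ _ G])
    fix V :: "'a set" and a b :: "'b \<Rightarrow> 'a"
    assume G: "edge_connected c V E a b" and n: "R < card V"
    have "0 \<le> ?K ^ R * s" using s by simp
    then have "?\<omega> I \<le> 1" for I by auto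
    then have "potts ?\<omega> V E a b (t / 4) \<le> ?K ^ card V"
      by (rule potts_le_card [OF edge_connectedD(1) [OF G]]) (use t in simp)
    also have "\<dots> = s ^ R * (?K ^ card V * (1 / s) ^ R)"
      using s by (simp add: power_divide)
    also have "\<dots> \<le> s ^ R * (?K ^ card V * (1 / s) ^ card V)"
      using s n by (intro mult_left_mono power_increasing) auto
    finally show "potts ?\<omega> V E a b (t / 4) \<le> s ^ R * (1 + (?K / s - 1)) ^ card V"
      by (simp add: power_divide)
  next
    fix V :: "'a set" and a b :: "'b \<Rightarrow> 'a" and u
    assume G: "edge_connected c V E a b" and n: "card V \<le> R" and u: "t / 4 \<le> u"
    have "0 \<le> u" using u t by linarith
    \<comment> \<open>The 8 in \<open>s\<close> is chosen so that \<open>exp (- u * c / 2)\<close>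
      equals \<open>s\<close> at \<open>u = t / 4\<close>.\<close>
    have "t / 4 * (c / 2) \<le> u * (c / 2)" using u c by (intro mult_right_mono) auto
    then have "exp (- u * c / 2) \<le> s" by (simp add: s_def)
    then have "?K ^ card V * (exp (- u * c / 2) * potts ?two V E a b u) \<le> ?K ^ R * (s * potts ?two V E a b u)"
      using K n s two_nonneg by (intro mult_mono power_increasing mult_nonneg_nonneg) auto
    with potts_three_colours_le [OF G \<open>0 \<le> u\<close> xy]
    have "potts ?\<omega> V E a b u \<le> 0"
      unfolding potts_diff_mult by (simp add: mult.assoc)
    also have "0 \<le> s ^ R * (1 + (?K / s - 1) * exp (- (u - t / 4) * c / 2)) ^ card V"
      using s \<beta> by (intro mult_nonneg_nonneg zero_le_power add_nonneg_nonneg) auto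
    finally show "potts ?\<omega> V E a b u \<le> s ^ R * (1 + (?K / s - 1) * exp (- (u - t / 4) * c / 2)) ^ card V" .
  qed (use s t in auto)
  also have "exp (- (t - t / 4) * c / 2) = s ^ 3"
    by (simp add: s_def exp_of_nat_mult [symmetric])
  also have "s ^ R * (1 + (?K / s - 1) * s ^ 3) ^ card V \<le> s ^ R * (1 + ?K * s\<^sup>2) ^ card V"
  proof (intro mult_left_mono power_mono add_left_mono)
    show "(?K / s - 1) * s ^ 3 \<le> ?K * s\<^sup>2"
      using s by (simp add: field_simps power_def numeral_eq_Suc)
    show "0 \<le> 1 + (?K / s - 1) * s ^ 3"
      using s \<beta> by (intro add_nonneg_nonneg mult_nonneg_nonneg) auto
  qed (use s in simp)
  finally have "potts ?\<omega> V E a b t \<le> s ^ R * (1 + ?K * s\<^sup>2) ^ card V" .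
  then show ?thesis unfolding potts_diff_mult by simp
qed

section \<open>Cuts and failure events\<close>

lemma cutsD:
  assumes "C \<in> cuts G" "X \<in> C"
  shows "C = {X, verts G - X}" "X \<subset> verts G" "X \<noteq> {}"
proof -
  have part: "partition_on (verts G) C" and card: "card C = 2"
    using assms(1) by (auto simp: cuts_def)
  obtain A B where AB: "C = {A, B}" "A \<noteq> B" using card unfolding card_2_iff by blast
  obtain Y where C: "C = {X, Y}" "X \<noteq> Y"
  proof (cases "X = A")
    case True
    then show ?thesis using that AB by blast
  next
    case False
    then have "X = B" using assms(2) AB by simp
    then show ?thesis using that [of A] AB by (simp add: insert_commute)
  qed
  have "\<Union>C = verts G" "{} \<notin> C" "X \<inter> Y = {}"
    using part C by (simp_all add: partition_on_def disjoint_def)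
  then have union: "X \<union> Y = verts G" and ne: "X \<noteq> {}" "Y \<noteq> {}" and disj: "X \<inter> Y = {}"
    using C(1) by auto
  have Y: "Y = verts G - X" using union disj by blast
  have X: "X \<subset> verts G" using union ne(2) disj by blast
  show "C = {X, verts G - X}" "X \<subset> verts G" "X \<noteq> {}"
    using C(1) Y X ne(1) by simp_all
qed

lemma cutsI:
  assumes "X \<subset> verts G" "X \<noteq> {}"
  shows "{X, verts G - X} \<in> cuts G"
proof -
  have "X \<noteq> verts G - X" using assms by blast
  moreover have "partition_on (verts G) {X, verts G - X}"
    unfolding partition_on_def disjoint_def using assms by blast
  ultimately show ?thesis by (simp add: cuts_def)
qed

lemma cut_nonempty: "C \<in> cuts G \<Longrightarrow> C \<noteq> {}"
  by (auto simp: cuts_def)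

lemma finite_cuts:
  assumes "multigraph G"
  shows "finite (cuts G)"
proof (rule finite_subset)
  show "cuts G \<subseteq> Pow (Pow (verts G))" by (auto dest: cutsD)
  show "finite (Pow (Pow (verts G)))" using assms by (simp add: multigraph_def)
qed

lemma cuts_exist:
  assumes "2 \<le> card (verts G)"
  shows "cuts G \<noteq> {}"
proof -
  have "verts G \<noteq> {}" using assms by auto
  then obtain v where "v \<in> verts G" by blast
  moreover have "verts G \<noteq> {v}" using assms by auto
  ultimately have "{v} \<subset> verts G" by blast
  then show ?thesis using cutsI [of "{v}" G] by blast
qed

lemma min_cut_value_le:
  assumes "multigraph G" "C \<in> cuts G"
  shows "min_cut_value G \<le> cut_value G C"
  unfolding min_cut_value_def using assms finite_cuts by (intro Min_le) auto

lemma min_cut_exists: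
  assumes "multigraph G" "2 \<le> card (verts G)"
  obtains C where "C \<in> cuts G" "cut_value G C = min_cut_value G"
proof -
  have "min_cut_value G \<in> cut_value G ` cuts G"
    unfolding min_cut_value_def
    using finite_cuts [OF assms(1)] cuts_exist [OF assms(2)] by (intro Min_in) auto
  then show ?thesis using that by auto
qed

section \<open>Cut edges as boundaries of vertex sets\<close>

text \<open>An arbitrary orientation of the edges, linking the set-valued \<open>ends\<close> to the
  two endpoint functions used for colourings.\<close>

definition endpoints :: "('v, 'e) mgraph \<Rightarrow> ('e \<Rightarrow> 'v) \<Rightarrow> ('e \<Rightarrow> 'v) \<Rightarrow> bool" where
  "endpoints G a b \<longleftrightarrow> (\<forall>e\<in>edges G. ends G e = {a e, b e})"

lemma endpoints_exist:
  assumes "multigraph G"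
  obtains a b where "endpoints G a b"
proof -
  have "\<forall>e\<in>edges G. \<exists>u v. ends G e = {u, v}"
    using assms unfolding multigraph_def card_2_iff by blast
  then obtain a b where "\<forall>e\<in>edges G. ends G e = {a e, b e}" by metis
  then have "endpoints G a b" by (simp only: endpoints_def)
  then show ?thesis by (rule that)
qed

lemma endpoints_subset:
  assumes "multigraph G" "endpoints G a b"
  shows "a ` edges G \<subseteq> verts G" "b ` edges G \<subseteq> verts G"
  using assms unfolding multigraph_def endpoints_def by fastforce+

lemma cut_edges_eq_boundary:
  assumes "multigraph G" "endpoints G a b" "C \<in> cuts G" "X \<in> C"
  shows "cut_edges G C = boundary (edges G) a b X"
proof -
  note C = cutsD [OF assms(3,4)]
  have "(\<forall>Y\<in>C. ends G e \<inter> Y \<noteq> {}) \<longleftrightarrow> (a e \<in> X) \<noteq> (b e \<in> X)" if "e \<in> edges G" for e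
  proof -
    have "ends G e = {a e, b e}" "a e \<in> verts G" "b e \<in> verts G"
      using assms(2) endpoints_subset [OF assms(1,2)] that by (auto simp: endpoints_def)
    then show ?thesis by (subst C(1)) auto
  qed
  then show ?thesis by (auto simp: cut_edges_def bichromatic_def)
qed

lemma edge_connected_min_cut_value:
  assumes "multigraph G" "endpoints G a b"
  shows "edge_connected (min_cut_value G) (verts G) (edges G) a b"
  unfolding edge_connected_def
proof (intro conjI allI impI)
  show "finite (verts G)" "finite (edges G)" using assms by (simp_all add: multigraph_def)
  show "a ` edges G \<subseteq> verts G" "b ` edges G \<subseteq> verts G" by (fact endpoints_subset [OF assms])+
  fix X assume "X \<subset> verts G" "X \<noteq> {}"
  then have "{X, verts G - X} \<in> cuts G" by (rule cutsI)
  from min_cut_value_le [OF assms(1) this] cut_edges_eq_boundary [OF assms this, of X]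
  show "real (min_cut_value G) \<le> real (card (boundary (edges G) a b X))"
    by (simp add: cut_value_def)
qed

text \<open>Both sides of a cut have the same boundary and distinct cuts share no side, whence the
  factor 2.\<close>

lemma sum_over_cut_sides:
  fixes f :: "nat \<Rightarrow> real"
  assumes "multigraph G" "endpoints G a b"
  shows "(\<Sum>X\<in>{X. X \<subset> verts G \<and> X \<noteq> {}}. f (card (boundary (edges G) a b X)))
    = 2 * (\<Sum>C\<in>cuts G. f (cut_value G C))"
proof -
  have sides: "{X. X \<subset> verts G \<and> X \<noteq> {}} = \<Union>(cuts G)"
  proof (intro equalityI subsetI)
    fix X assume "X \<in> {X. X \<subset> verts G \<and> X \<noteq> {}}"
    then show "X \<in> \<Union>(cuts G)" using cutsI [of X G] by blast
  next
    fix X assume "X \<in> \<Union>(cuts G)"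
    then show "X \<in> {X. X \<subset> verts G \<and> X \<noteq> {}}" using cutsD(2,3) by blast
  qed
  have "(\<Sum>X\<in>\<Union>(cuts G). f (card (boundary (edges G) a b X)))
      = (\<Sum>C\<in>cuts G. \<Sum>X\<in>C. f (card (boundary (edges G) a b X)))"
  proof (subst sum.Union_disjoint)
    show "\<forall>C\<in>cuts G. finite C"
      by (auto simp: cuts_def intro: card_ge_0_finite)
    show "\<forall>C\<in>cuts G. \<forall>D\<in>cuts G. C \<noteq> D \<longrightarrow> C \<inter> D = {}"
      using cutsD(1) by blast
  qed simp
  also have "\<dots> = (\<Sum>C\<in>cuts G. 2 * f (cut_value G C))"
  proof (rule sum.cong [OF refl])
    fix C assume C: "C \<in> cuts G"
    have "(\<Sum>X\<in>C. f (card (boundary (edges G) a b X))) = (\<Sum>X\<in>C. f (cut_value G C))"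
      using cut_edges_eq_boundary [OF assms C] by (simp add: cut_value_def)
    also have "\<dots> = 2 * f (cut_value G C)" using C by (simp add: cuts_def)
    finally show "(\<Sum>X\<in>C. f (card (boundary (edges G) a b X))) = 2 * f (cut_value G C)" .
  qed
  finally show ?thesis by (simp add: sides sum_distrib_left)
qed

section \<open>Failure events and bounds for their union\<close>

lemma prob_edges_fail:
  assumes "finite (edges G)" "S \<subseteq> edges G" "0 < p" "p < 1"
  shows "measure_pmf.prob (edge_failures G p) {f. \<forall>e\<in>S. f e} = p ^ card S"
proof -
  \<comment> \<open>A product event: edges in \<open>S\<close> are forced to fail, the others are
    free. That \<open>S\<close> lies inside \<open>edges G\<close> matters, since all other
    coordinates have the default \<open>False\<close>.\<close>
  let ?B = "\<lambda>e. if e \<in> S then {True} else UNIV"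
  have "{f. \<forall>e\<in>S. f e} = Pi (edges G) ?B"
    using assms(2) by (auto simp: Pi_def)
  then have "measure_pmf.prob (edge_failures G p) {f. \<forall>e\<in>S. f e}
      = (\<Prod>e\<in>edges G. measure_pmf.prob (bernoulli_pmf p) (?B e))"
    by (simp only: edge_failures_def measure_Pi_pmf_Pi [OF assms(1)])
  also have "\<dots> = (\<Prod>e\<in>edges G. if e \<in> S then p else 1)"
    using assms by (intro prod.cong) (auto simp: measure_pmf_single)
  also have "\<dots> = p ^ card S"
    using assms by (simp add: prod.If_cases Int_absorb1)
  finally show ?thesis .
qed

definition cut_failure :: "('v, 'e) mgraph \<Rightarrow> 'v set set \<Rightarrow> ('e \<Rightarrow> bool) set" where
  "cut_failure G C = {f. \<forall>e\<in>cut_edges G C. f e}"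

lemma cut_edges_subset: "cut_edges G C \<subseteq> edges G"
  by (auto simp: cut_edges_def)

lemma prob_cut_failure:
  assumes "multigraph G" "0 < p" "p < 1"
  shows "measure_pmf.prob (edge_failures G p) (cut_failure G C) = p ^ cut_value G C"
  unfolding cut_failure_def cut_value_def
  using assms by (intro prob_edges_fail cut_edges_subset) (auto simp: multigraph_def)

lemma prob_two_cut_failures:
  assumes "multigraph G" "0 < p" "p < 1"
  shows "measure_pmf.prob (edge_failures G p) (cut_failure G C \<inter> cut_failure G D)
    = p ^ card (cut_edges G C \<union> cut_edges G D)"
proof -
  have "cut_failure G C \<inter> cut_failure G D = {f. \<forall>e\<in>cut_edges G C \<union> cut_edges G D. f e}"
    by (auto simp: cut_failure_def)
  moreover have "cut_edges G C \<union> cut_edges G D \<subseteq> edges G"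
    by (intro Un_least cut_edges_subset)
  moreover have "finite (edges G)" using assms(1) by (simp add: multigraph_def)
  ultimately show ?thesis
    by (simp only: prob_edges_fail [OF _ _ assms(2,3)])
qed

lemma disconnected_iff_cut_failure:
  assumes G: "multigraph G"
  shows "\<not> connected_graph (surviving_graph G f) \<longleftrightarrow> f \<in> (\<Union>C\<in>cuts G. cut_failure G C)"
proof
  let ?R = "adjacency (surviving_graph G f)"
  assume "\<not> connected_graph (surviving_graph G f)"
  then obtain u v where uv: "u \<in> verts G" "v \<in> verts G" "(u, v) \<notin> ?R\<^sup>*"
    by (auto simp: connected_graph_def surviving_graph_def)
  \<comment> \<open>The surviving component of \<open>u\<close>: an edge leaving it must have
    failed, or its far end would be reachable.\<close>
  define X where "X = {w \<in> verts G. (u, w) \<in> ?R\<^sup>*}"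
  have X: "X \<subset> verts G" "X \<noteq> {}" using uv by (auto simp: X_def)
  have "f e" if e: "e \<in> cut_edges G {X, verts G - X}" for e
  proof (rule ccontr)
    assume "\<not> f e"
    have eG: "e \<in> edges G" "card (ends G e) = 2" "ends G e \<inter> X \<noteq> {}" "ends G e \<inter> (verts G - X) \<noteq> {}"
      using e G by (auto simp: cut_edges_def multigraph_def)
    then obtain x y where xy: "x \<in> X" "y \<in> verts G - X" "x \<in> ends G e" "y \<in> ends G e" by blast
    then have "x \<noteq> y" by blast
    then have "ends G e = {x, y}"
      using eG(2) xy by (auto simp: card_2_iff)
    then have "(x, y) \<in> ?R"
      using eG(1) \<open>\<not> f e\<close> by (auto simp: adjacency_def surviving_graph_def)
    then have "y \<in> X" using xy unfolding X_def by (auto intro: rtrancl_into_rtrancl)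
    then show False using xy by blast
  qed
  then have "f \<in> cut_failure G {X, verts G - X}" by (simp add: cut_failure_def)
  then show "f \<in> (\<Union>C\<in>cuts G. cut_failure G C)" using cutsI [OF X] by blast
next
  let ?R = "adjacency (surviving_graph G f)"
  assume "f \<in> (\<Union>C\<in>cuts G. cut_failure G C)"
  then obtain C where C: "C \<in> cuts G" "\<forall>e\<in>cut_edges G C. f e"
    by (auto simp: cut_failure_def)
  obtain X where X: "X \<in> C" using cut_nonempty [OF C(1)] by blast
  note CX = cutsD [OF C(1) X]
  obtain u v where uv: "u \<in> X" "u \<in> verts G" "v \<in> verts G" "v \<notin> X"
    using CX(2,3) by blast
  \<comment> \<open>No surviving edge leaves \<open>X\<close>, because such an edge would belong to
    the failed cut.\<close>
  have "w \<in> X" if "(u, w) \<in> ?R\<^sup>*" for w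
    using that
  proof induction
    case base
    show ?case by (fact uv)
  next
    case (step y z)
    from step(2) obtain e where e: "e \<in> edges G" "\<not> f e" "ends G e = {y, z}"
      by (auto simp: adjacency_def surviving_graph_def)
    then have "z \<in> verts G" using G by (auto simp: multigraph_def)
    show ?case
    proof (rule ccontr)
      assume "z \<notin> X"
      then have "e \<in> cut_edges G C"
        using e \<open>z \<in> verts G\<close> step(3) by (subst CX(1)) (auto simp: cut_edges_def)
      then show False using C(2) e(2) by blast
    qed
  qed
  then have "(u, v) \<notin> ?R\<^sup>*" using uv by blast
  then show "\<not> connected_graph (surviving_graph G f)"
    using uv by (auto simp: connected_graph_def surviving_graph_def)
qed

lemma FAIL_eq:
  assumes "multigraph G"
  shows "FAIL G p = measure_pmf.prob (edge_failures G p) (\<Union>C\<in>cuts G. cut_failure G C)"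
  unfolding FAIL_def using disconnected_iff_cut_failure [OF assms]
  by (intro arg_cong [where f = "measure_pmf.prob (edge_failures G p)"]) blast

lemma FAIL_le_sum_cuts:
  assumes "multigraph G" "0 < p" "p < 1"
  shows "FAIL G p \<le> (\<Sum>C\<in>cuts G. p ^ cut_value G C)"
  unfolding FAIL_eq [OF assms(1)] prob_cut_failure [OF assms, symmetric]
  by (rule measure_UNION_le) (simp_all add: finite_cuts assms)

text \<open>The failure of one minimum cut already disconnects the graph. This reduces the case of
  small \<open>FAIL G p\<close> to that of small \<open>p ^ min_cut_value G\<close>, and bounds the
  sum over all cuts from below.\<close>

lemma min_cut_failure_le_FAIL:
  assumes "multigraph G" "2 \<le> card (verts G)" "0 < p" "p < 1"
  shows "p ^ min_cut_value G \<le> FAIL G p"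
proof -
  obtain C where C: "C \<in> cuts G" "cut_value G C = min_cut_value G"
    using min_cut_exists assms(1,2) by blast
  have "p ^ min_cut_value G = measure_pmf.prob (edge_failures G p) (cut_failure G C)"
    using prob_cut_failure [OF assms(1,3,4)] C(2) by simp
  also have "\<dots> \<le> FAIL G p"
    unfolding FAIL_eq [OF assms(1)] using C(1)
    by (intro measure_pmf.finite_measure_mono) auto
  finally show ?thesis .
qed

text \<open>A Bonferroni inequality in which each unordered pair is subtracted twice, to match
  ordered pairs of cuts.\<close>

lemma prob_UNION_ge:
  assumes "finite I"
  shows "(\<Sum>i\<in>I. measure_pmf.prob M (A i)) - (\<Sum>i\<in>I. \<Sum>j\<in>I - {i}. measure_pmf.prob M (A i \<inter> A j))
    \<le> measure_pmf.prob M (\<Union>i\<in>I. A i)"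
  using assms
proof (induction I rule: finite_induct)
  case empty
  then show ?case by simp
next
  case (insert k I)
  let ?P = "measure_pmf.prob M"
  let ?U = "\<Union>i\<in>I. A i"
  have "?P (A k \<inter> ?U) = ?P (\<Union>j\<in>I. A k \<inter> A j)" by (rule arg_cong) blast
  also have "\<dots> \<le> (\<Sum>j\<in>I. ?P (A k \<inter> A j))" by (rule measure_UNION_le) (use insert in auto)
  finally have int: "?P (A k \<inter> ?U) \<le> (\<Sum>j\<in>I. ?P (A k \<inter> A j))" .
  \<comment> \<open>Adding \<open>k\<close> costs only the pairs with \<open>k\<close> first; those
    with \<open>k\<close> second merely enlarge the subtracted sum.\<close>
  have "(\<Sum>i\<in>I. \<Sum>j\<in>I - {i}. ?P (A i \<inter> A j)) \<le> (\<Sum>i\<in>I. \<Sum>j\<in>insert k I - {i}. ?P (A i \<inter> A j))"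
    using insert(1) by (intro sum_mono sum_mono2) auto
  moreover have "?P (A k \<union> ?U) = ?P (A k) + ?P ?U - ?P (A k \<inter> ?U)"
    using measure_Un3 [of "A k" "measure_pmf M" ?U] by (simp add: measure_pmf.fmeasurable_eq_sets)
  ultimately show ?case
    using insert int by simp
qed

section \<open>Approximation of the failure probability\<close>

text \<open>The double negation exhibits the time \<open>- ln p\<close> at which
  \<open>potts\<close> is evaluated.\<close>

lemma power_eq_exp:
  "0 < p \<Longrightarrow> p ^ m = exp (- (- ln p) * real m)" for p :: real
  by (simp add: exp_of_nat2_mult)

section \<open>Pairs of cuts as colourings with four colours\<close>

text \<open>Both coordinates take both values, and they neither always agree nor always differ. So
  each of the six two-element sets of colours meets the image, and at most one of the four colours
  is missing.\<close>

lemma card_classes_of_two_sides: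
  fixes V X Y :: "'v set"
  assumes "finite V" and X: "X \<subset> V" "X \<noteq> {}" and Y: "Y \<subset> V" "Y \<noteq> {}"
    and XY: "X \<noteq> Y" "Y \<noteq> V - X"
  shows "3 \<le> card ((\<lambda>v. (v \<in> X, v \<in> Y)) ` V)"
proof -
  let ?I = "(\<lambda>v. (v \<in> X, v \<in> Y)) ` V"
  have mem: "(v \<in> X, v \<in> Y) \<in> ?I" if "v \<in> V" for v using that by (rule imageI)
  obtain x where "x \<in> X" "x \<in> V" using X by blast
  then have x: "(True, True) \<in> ?I \<or> (True, False) \<in> ?I" using mem [of x] by (cases "x \<in> Y") simp_all
  obtain x' where "x' \<notin> X" "x' \<in> V" using X by blast
  then have x': "(False, True) \<in> ?I \<or> (False, False) \<in> ?I" using mem [of x'] by (cases "x' \<in> Y") simp_all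
  obtain y where "y \<in> Y" "y \<in> V" using Y by blast
  then have y: "(True, True) \<in> ?I \<or> (False, True) \<in> ?I" using mem [of y] by (cases "y \<in> X") simp_all
  obtain y' where "y' \<notin> Y" "y' \<in> V" using Y by blast
  then have y': "(True, False) \<in> ?I \<or> (False, False) \<in> ?I" using mem [of y'] by (cases "y' \<in> X") simp_all
  obtain z where "z \<in> V" "(z \<in> X) \<noteq> (z \<in> Y)" using XY(1) X(1) Y(1) by blast
  then have z: "(True, False) \<in> ?I \<or> (False, True) \<in> ?I" using mem [of z] by (cases "z \<in> X") simp_all
  obtain w where "w \<in> V" "(w \<in> X) = (w \<in> Y)" using XY(2) Y(1) by blast
  then have w: "(True, True) \<in> ?I \<or> (False, False) \<in> ?I" using mem [of w] by (cases "w \<in> X") simp_all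
  have "\<exists>S. S \<subseteq> ?I \<and> card S = 3"
  proof -
    have "{(True, True), (True, False), (False, True)} \<subseteq> ?I \<or> {(True, True), (True, False), (False, False)} \<subseteq> ?I
        \<or> {(True, True), (False, True), (False, False)} \<subseteq> ?I \<or> {(True, False), (False, True), (False, False)} \<subseteq> ?I"
      unfolding insert_subset using x x' y y' z w empty_subsetI [of ?I] by argo
    then show ?thesis
      by (elim disjE) (rule exI, erule conjI, simp)+
  qed
  then obtain S where "S \<subseteq> ?I" "card S = 3" by blast
  then show ?thesis using card_mono [of ?I S] assms(1) by simp
qed

text \<open>Vertices are coloured by membership in a chosen side of each of the two cuts. An edge is
  bichromatic iff it lies in one of the cuts, and distinct cuts produce at least three
  colours.\<close>

lemma sum_cut_pairs_le_potts:
  assumes G: "multigraph G" "endpoints G a b" and p: "0 < p"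
  shows "(\<Sum>C\<in>cuts G. \<Sum>D\<in>cuts G - {C}. p ^ card (cut_edges G C \<union> cut_edges G D))
    \<le> potts (\<lambda>I::(bool \<times> bool) set. if 3 \<le> card I then 1 else 0) (verts G) (edges G) a b (- ln p)"
proof -
  let ?V = "verts G" and ?E = "edges G"
  have fin: "finite ?V" using G(1) by (simp add: multigraph_def)
  define side where "side C = (SOME X. X \<in> C)" for C :: "'a set set"
  have side: "side C \<in> C" if "C \<in> cuts G" for C
    unfolding side_def using cut_nonempty [OF that] by (simp add: some_in_eq)
  define col where "col = (\<lambda>(C, D). \<lambda>v\<in>?V. (v \<in> side C, v \<in> side D))"
  let ?P = "SIGMA C:cuts G. cuts G - {C}"
  let ?S = "{\<sigma> \<in> ?V \<rightarrow>\<^sub>E (UNIV :: (bool \<times> bool) set). 3 \<le> card (\<sigma> ` ?V)}"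
  have col_at: "col (C, D) v = (v \<in> side C, v \<in> side D)" if "v \<in> ?V" for C D v
    using that by (simp add: col_def)
  \<comment> \<open>Agreement on \<open>?V\<close> fixes both sides, and a side fixes its
    cut.\<close>
  have inj: "inj_on col ?P"
  proof (rule inj_onI)
    fix x x' assume "x \<in> ?P" "x' \<in> ?P" "col x = col x'"
    moreover obtain C D C' D' where x: "x = (C, D)" "x' = (C', D')" by (cases x, cases x')
    ultimately have C: "C \<in> cuts G" "D \<in> cuts G" "C' \<in> cuts G" "D' \<in> cuts G"
      and eq: "col (C, D) = col (C', D')" by simp_all
    have *: "v \<in> side C \<longleftrightarrow> v \<in> side C'" "v \<in> side D \<longleftrightarrow> v \<in> side D'" if "v \<in> ?V" for v
      using col_at [OF that, of C D] col_at [OF that, of C' D'] eq by simp_all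
    have sub: "side B \<subseteq> ?V" if "B \<in> cuts G" for B
      using cutsD(2) [OF that side [OF that]] by blast
    have "side C = side C'"
      using *(1) sub [OF C(1)] sub [OF C(3)] by blast
    moreover have "side D = side D'"
      using *(2) sub [OF C(2)] sub [OF C(4)] by blast
    ultimately show "x = x'"
      using cutsD(1) [OF C(1) side [OF C(1)]] cutsD(1) [OF C(2) side [OF C(2)]]
        cutsD(1) [OF C(3) side [OF C(3)]] cutsD(1) [OF C(4) side [OF C(4)]] x by simp
  qed
  have "(\<Sum>C\<in>cuts G. \<Sum>D\<in>cuts G - {C}. p ^ card (cut_edges G C \<union> cut_edges G D))
      = (\<Sum>(C, D)\<in>?P. p ^ card (cut_edges G C \<union> cut_edges G D))"
    by (rule sum.Sigma) (simp_all add: finite_cuts G)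
  also have "\<dots> = (\<Sum>x\<in>?P. exp (- (- ln p) * real (card (bichromatic ?E a b (col x)))))"
  proof (rule sum.cong [OF refl])
    fix x assume "x \<in> ?P"
    then obtain C D where x: "x = (C, D)" and C: "C \<in> cuts G" "D \<in> cuts G" by blast
    have "bichromatic ?E a b (col (C, D)) = cut_edges G C \<union> cut_edges G D"
      unfolding cut_edges_eq_boundary [OF G C(1) side [OF C(1)]]
        cut_edges_eq_boundary [OF G C(2) side [OF C(2)]]
    proof (intro equalityI subsetI)
      fix e
      have "col (C, D) (a e) = (a e \<in> side C, a e \<in> side D)"
        "col (C, D) (b e) = (b e \<in> side C, b e \<in> side D)" if "e \<in> ?E"
        using col_at endpoints_subset [OF G] that by auto
      then show "e \<in> bichromatic ?E a b (col (C, D)) \<Longrightarrow>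
            e \<in> boundary ?E a b (side C) \<union> boundary ?E a b (side D)"
          "e \<in> boundary ?E a b (side C) \<union> boundary ?E a b (side D) \<Longrightarrow>
            e \<in> bichromatic ?E a b (col (C, D))"
        by (auto simp: bichromatic_def)
    qed
    then show "(case x of (C, D) \<Rightarrow> p ^ card (cut_edges G C \<union> cut_edges G D))
        = exp (- (- ln p) * real (card (bichromatic ?E a b (col x))))"
      by (simp only: x prod.case power_eq_exp [OF p])
  qed
  also have "\<dots> = (\<Sum>\<sigma>\<in>col ` ?P. exp (- (- ln p) * real (card (bichromatic ?E a b \<sigma>))))"
    by (rule sum.reindex [OF inj, symmetric, unfolded comp_def])
  also have "\<dots> \<le> (\<Sum>\<sigma>\<in>?S. exp (- (- ln p) * real (card (bichromatic ?E a b \<sigma>))))"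
  proof (rule sum_mono2)
    show "finite ?S" by (rule finite_subset [OF _ finite_PiE]) (use fin in auto)
    show "col ` ?P \<subseteq> ?S"
    proof
      fix \<sigma> assume "\<sigma> \<in> col ` ?P"
      then obtain C D where \<sigma>: "\<sigma> = col (C, D)" and C: "C \<in> cuts G" "D \<in> cuts G" "D \<noteq> C"
        by blast
      note X = cutsD [OF C(1) side [OF C(1)]] and Y = cutsD [OF C(2) side [OF C(2)]]
      have "side D \<noteq> ?V - side C"
      proof
        assume eq: "side D = ?V - side C"
        then have "?V - side D = side C" using X(2) by blast
        then show False using X(1) Y(1) eq C(3) by (simp add: insert_commute)
      qed
      moreover have "side C \<noteq> side D" using X(1) Y(1) C(3) by metis
      ultimately have "3 \<le> card ((\<lambda>v. (v \<in> side C, v \<in> side D)) ` ?V)"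
        by (intro card_classes_of_two_sides fin X Y)
      then have "3 \<le> card (col (C, D) ` ?V)"
        using col_at by (simp cong: image_cong_simp)
      moreover have "col (C, D) \<in> ?V \<rightarrow>\<^sub>E UNIV" by (simp add: col_def)
      ultimately show "\<sigma> \<in> ?S" by (simp add: \<sigma>)
    qed
  qed simp
  also have "\<dots> = potts (\<lambda>I::(bool \<times> bool) set. if 3 \<le> card I then 1 else 0) ?V ?E a b (- ln p)"
    by (rule potts_indicator [OF fin, symmetric])
  finally show ?thesis .
qed

text \<open>The three-colour bound is used with \<open>R = 9\<close>: as
  \<open>s ^ 8 = p ^ min_cut_value G\<close>, the ninth power leaves a spare factor
  \<open>s\<close>, at most n to the power -1/2, while \<open>s ^ 2\<close> at most 1/n keeps
  \<open>(1 + 4 * s ^ 2) ^ n\<close> below \<open>exp 4\<close>.\<close>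

lemma sum_cuts_le_FAIL:
  assumes G: "multigraph G" and n: "2 \<le> card (verts G)" and p: "0 < p" "p < 1"
    and small: "p ^ min_cut_value G < real (card (verts G)) powr (-4)"
  shows "(1 - (2 * 4 ^ 9 + exp 4) * real (card (verts G)) powr (- 1 / 2)) * (\<Sum>C\<in>cuts G. p ^ cut_value G C)
    \<le> FAIL G p"
proof -
  let ?n = "card (verts G)" and ?c = "real (min_cut_value G)" and ?t = "- ln p"
  let ?A = "\<Sum>C\<in>cuts G. p ^ cut_value G C"
  define s where "s = exp (- ?t * ?c / 8)"
  obtain a b where ab: "endpoints G a b" using endpoints_exist [OF G] .
  note conn = edge_connected_min_cut_value [OF G ab]
  have t: "0 \<le> ?t" using p by simp
  have s0: "0 < s" by (simp add: s_def)
  have s8: "s ^ 8 = p ^ min_cut_value G"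
    unfolding power_eq_exp [OF p(1)] s_def by (simp add: exp_of_nat_mult [symmetric])
  have s_less: "s \<le> real ?n powr (- 1 / 2)"
  proof (rule power_le_imp_le_base)
    show "s ^ Suc 7 \<le> (real ?n powr (- 1 / 2)) ^ Suc 7"
      using small s8 n by (simp add: powr_power)
  qed simp
  have s2: "s\<^sup>2 \<le> 1 / ?n"
  proof -
    have "s\<^sup>2 \<le> (real ?n powr (- 1 / 2))\<^sup>2" using s_less s0 by (intro power_mono) auto
    also have "\<dots> = 1 / ?n" using n by (subst powr_power) (auto simp: powr_minus_divide)
    finally show ?thesis .
  qed
  have A: "p ^ min_cut_value G \<le> ?A"
    using min_cut_failure_le_FAIL [OF G n p] FAIL_le_sum_cuts [OF G p] by linarith
  then have A0: "0 \<le> ?A" using p by (meson zero_le_power less_imp_le order_trans)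
  have "(1 + 4 * s\<^sup>2) ^ ?n \<le> exp (4 * s\<^sup>2) ^ ?n"
    by (intro power_mono exp_ge_add_one_self) simp
  also have "\<dots> = exp (4 * (?n * s\<^sup>2))" by (simp add: exp_of_nat_mult [symmetric] mult_ac)
  also have "\<dots> \<le> exp 4" using s2 n by (simp add: field_simps)
  finally have e4: "(1 + 4 * s\<^sup>2) ^ ?n \<le> exp 4" .
  let ?two = "potts (\<lambda>I. if I = {(False, False), (True, False)} then 1 else 0) (verts G) (edges G) a b ?t"
  have "?two = (\<Sum>X\<in>{X. X \<subset> verts G \<and> X \<noteq> {}}. exp (- ?t * real (card (boundary (edges G) a b X))))"
    by (rule potts_two_colours [OF edge_connectedD(1,3,4) [OF conn]]) simp
  also have "\<dots> = 2 * (\<Sum>C\<in>cuts G. exp (- ?t * real (cut_value G C)))"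
    by (rule sum_over_cut_sides [OF G ab, of "\<lambda>m. exp (- ?t * real m)"])
  finally have two: "?two = 2 * ?A" by (simp only: power_eq_exp [OF p(1)])
  have "(\<Sum>C\<in>cuts G. \<Sum>D\<in>cuts G - {C}. p ^ card (cut_edges G C \<union> cut_edges G D))
      \<le> potts (\<lambda>I::(bool \<times> bool) set. if 3 \<le> card I then 1 else 0) (verts G) (edges G) a b ?t"
    by (rule sum_cut_pairs_le_potts [OF G ab p(1)])
  also have "\<dots> \<le> real CARD(bool \<times> bool) ^ 9 * s * ?two
      + s ^ 9 * (1 + real CARD(bool \<times> bool) * s\<^sup>2) ^ ?n"
    unfolding s_def by (rule potts_three_colours_comparison [OF conn _ t]) simp_all
  \<comment> \<open>There are 4 colours, and the factor 2 comes from the two sides of a cut. In the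
    error term \<open>p ^ min_cut_value G\<close> is next absorbed into \<open>?A\<close>.\<close>
  also have "\<dots> = 4 ^ 9 * s * (2 * ?A) + s * p ^ min_cut_value G * (1 + 4 * s\<^sup>2) ^ ?n"
    unfolding two s8 [symmetric] by (simp add: power_numeral_reduce)
  also have "\<dots> \<le> 4 ^ 9 * s * (2 * ?A) + s * ?A * exp 4"
    using A A0 e4 s0 by (intro add_left_mono mult_mono mult_left_mono) auto
  also have "\<dots> = (2 * 4 ^ 9 + exp 4) * s * ?A" by (simp add: algebra_simps)
  also have "\<dots> \<le> (2 * 4 ^ 9 + exp 4) * real ?n powr (- 1 / 2) * ?A"
    using s_less A0 by (intro mult_right_mono mult_left_mono add_nonneg_nonneg) auto
  finally have pairs: "(\<Sum>C\<in>cuts G. \<Sum>D\<in>cuts G - {C}. p ^ card (cut_edges G C \<union> cut_edges G D))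
      \<le> (2 * 4 ^ 9 + exp 4) * real ?n powr (- 1 / 2) * ?A" .
  have "?A - (\<Sum>C\<in>cuts G. \<Sum>D\<in>cuts G - {C}. p ^ card (cut_edges G C \<union> cut_edges G D)) \<le> FAIL G p"
    using prob_UNION_ge [OF finite_cuts [OF G], of "edge_failures G p" "cut_failure G"]
    unfolding FAIL_eq [OF G] prob_cut_failure [OF G p] prob_two_cut_failures [OF G p] .
  with pairs show ?thesis by (simp add: left_diff_distrib)
qed

section \<open>Strong cuts and the relative error\<close>

text \<open>A cut of value \<open>r * c\<close> has weight
  \<open>n powr (- \<delta> * r) * n powr (- 2 * r)\<close>. The threshold for weak cuts is the
  \<open>r\<close> at which the first factor equals \<open>\<epsilon> * p ^ c\<close>, so it is
  smaller for strong cuts; the second factors sum to a constant.\<close>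

lemma sum_strong_cuts_le:
  assumes G: "multigraph G" and n: "2 \<le> card (verts G)" and p: "0 < p" "p < 1"
    and eq: "p ^ min_cut_value G = real (card (verts G)) powr (-(2 + \<delta>))"
    and \<delta>: "0 < \<delta>" and \<epsilon>: "0 < \<epsilon>"
  shows "(\<Sum>C\<in>cuts G - weak_cuts G \<delta> \<epsilon>. p ^ cut_value G C) \<le> exp 1 * \<epsilon> * p ^ min_cut_value G"
proof -
  let ?n = "real (card (verts G))" and ?c = "real (min_cut_value G)"
  define L where "L = ln ?n"
  have L: "0 < L" using n by (simp add: L_def)
  have pc: "p ^ min_cut_value G = exp (- (2 + \<delta>) * L)"
    using eq n by (simp add: powr_def L_def)
  have "exp (- (2 + \<delta>) * L) < 1" using \<delta> L by (simp add: mult_neg_pos)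
  then have c: "0 < ?c" using pc by (cases "min_cut_value G = 0") auto
  have "?c * ln p = - (2 + \<delta>) * L"
    using pc p by (metis ln_exp ln_realpow)
  then have lnp: "ln p = - (2 + \<delta>) * L / ?c" using c by (simp add: field_simps)
  \<comment> \<open>At this time \<open>exp (- t * m)\<close> is \<open>n powr (- 2 * m / c)\<close>
    and \<open>exp (- t * c / 2)\<close> is \<open>1 / n\<close>.\<close>
  define t where "t = 2 * L / ?c"
  have t: "0 \<le> t" using L c by (simp add: t_def)
  obtain a b where ab: "endpoints G a b" using endpoints_exist [OF G] .
  have "2 * (\<Sum>C\<in>cuts G. exp (- t * real (cut_value G C)))
      = (\<Sum>X\<in>{X. X \<subset> verts G \<and> X \<noteq> {}}. exp (- t * real (card (boundary (edges G) a b X))))"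
    by (rule sum_over_cut_sides [OF G ab, of "\<lambda>m. exp (- t * real m)", symmetric])
  also have "\<dots> \<le> (1 + exp (- t * ?c / 2)) ^ card (verts G)"
    by (rule sum_cut_weights_le [OF edge_connected_min_cut_value [OF G ab] _ t]) simp
  also have "exp (- t * ?c / 2) = 1 / ?n"
    using c n by (simp add: t_def L_def exp_minus field_simps)
  also have "(1 + 1 / ?n) ^ card (verts G) \<le> exp (1 / ?n) ^ card (verts G)"
    by (intro power_mono exp_ge_add_one_self) simp
  also have "\<dots> = exp 1" using n by (simp add: exp_of_nat_mult [symmetric])
  finally have count: "(\<Sum>C\<in>cuts G. exp (- t * real (cut_value G C))) \<le> exp 1"
    using sum_nonneg [of "cuts G" "\<lambda>C. exp (- t * real (cut_value G C))"] by simp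
  have strong: "p ^ cut_value G C \<le> \<epsilon> * p ^ min_cut_value G * exp (- t * real (cut_value G C))"
    if "C \<in> cuts G - weak_cuts G \<delta> \<epsilon>" for C
  proof -
    define r where "r = real (cut_value G C) / ?c"
    have "(1 + 2 / \<delta> - ln \<epsilon> / (\<delta> * L)) * ?c \<le> real (cut_value G C)"
      using that by (auto simp: weak_cuts_def alpha_minimum_cuts_def L_def)
    then have "1 + 2 / \<delta> - ln \<epsilon> / (\<delta> * L) \<le> r"
      using c by (simp add: r_def pos_le_divide_eq)
    then have "\<delta> * L * (1 + 2 / \<delta> - ln \<epsilon> / (\<delta> * L)) \<le> \<delta> * L * r"
      using \<delta> L by (intro mult_left_mono) auto
    moreover have "\<delta> * L * (1 + 2 / \<delta> - ln \<epsilon> / (\<delta> * L)) = (2 + \<delta>) * L - ln \<epsilon>"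
      using \<delta> L by (simp add: field_simps)
    ultimately have le: "- \<delta> * L * r \<le> ln \<epsilon> + (- (2 + \<delta>) * L)"
      by (simp add: algebra_simps)
    have "p ^ cut_value G C = exp (ln p * real (cut_value G C))"
      by (simp add: power_eq_exp [OF p(1)])
    also have "ln p * real (cut_value G C) = - \<delta> * L * r + - t * real (cut_value G C)"
      unfolding lnp r_def t_def using c by (simp add: field_simps)
    also have "exp \<dots> \<le> exp (ln \<epsilon> + (- (2 + \<delta>) * L) + - t * real (cut_value G C))"
      using le by simp
    also have "\<dots> = \<epsilon> * p ^ min_cut_value G * exp (- t * real (cut_value G C))"
      unfolding exp_add pc using \<epsilon> by simp
    finally show ?thesis .
  qed
  have "(\<Sum>C\<in>cuts G - weak_cuts G \<delta> \<epsilon>. p ^ cut_value G C)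
      \<le> (\<Sum>C\<in>cuts G - weak_cuts G \<delta> \<epsilon>. \<epsilon> * p ^ min_cut_value G * exp (- t * real (cut_value G C)))"
    by (rule sum_mono) (fact strong)
  also have "\<dots> \<le> (\<Sum>C\<in>cuts G. \<epsilon> * p ^ min_cut_value G * exp (- t * real (cut_value G C)))"
    using \<epsilon> p finite_cuts [OF G] by (intro sum_mono2) auto
  also have "\<dots> = \<epsilon> * p ^ min_cut_value G * (\<Sum>C\<in>cuts G. exp (- t * real (cut_value G C)))"
    by (rule sum_distrib_left [symmetric])
  also have "\<dots> \<le> \<epsilon> * p ^ min_cut_value G * exp 1"
    using count \<epsilon> p by (intro mult_left_mono) auto
  finally show ?thesis by (simp add: mult_ac)
qed

text \<open>Both the weak cut sum and \<open>FAIL G p\<close> lie between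
  \<open>(1 - \<kappa>) * ?A\<close> and \<open>?A\<close>, so they differ by at most
  \<open>\<kappa> * ?A\<close>, and \<open>\<kappa> \<le> 1 / 2\<close> gives
  \<open>?A \<le> 2 * FAIL G p\<close>.\<close>

lemma weak_cut_sum_approximates_FAIL:
  assumes G: "multigraph G" and n: "2 \<le> card (verts G)" and p: "0 < p" "p < 1"
    and eq: "p ^ min_cut_value G = real (card (verts G)) powr (-(2 + \<delta>))"
    and small: "p ^ min_cut_value G < real (card (verts G)) powr (-4)"
    and \<epsilon>: "0 < \<epsilon>" "exp 1 * \<epsilon> \<le> \<kappa>"
    and \<kappa>: "(2 * 4 ^ 9 + exp 4) * real (card (verts G)) powr (- 1 / 2) \<le> \<kappa>" "\<kappa> \<le> 1 / 2" "2 * \<kappa> \<le> \<eta>"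
  shows "\<bar>(\<Sum>C\<in>weak_cuts G \<delta> \<epsilon>. p ^ cut_value G C) - FAIL G p\<bar> \<le> \<eta> * FAIL G p"
proof -
  let ?A = "\<Sum>C\<in>cuts G. p ^ cut_value G C"
  let ?W = "\<Sum>C\<in>weak_cuts G \<delta> \<epsilon>. p ^ cut_value G C"
  have \<delta>: "0 < \<delta>"
  proof -
    have "real (card (verts G)) powr (-(2 + \<delta>)) < real (card (verts G)) powr (-4)"
      using eq small by simp
    then show ?thesis using n by (simp add: powr_less_cancel_iff)
  qed
  have pA: "p ^ min_cut_value G \<le> ?A" and F0: "0 \<le> FAIL G p" and FA: "FAIL G p \<le> ?A"
    using min_cut_failure_le_FAIL [OF G n p] FAIL_le_sum_cuts [OF G p] by (auto simp: FAIL_def)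
  have "weak_cuts G \<delta> \<epsilon> \<subseteq> cuts G" by (auto simp: weak_cuts_def alpha_minimum_cuts_def)
  then have split: "(\<Sum>C\<in>cuts G - weak_cuts G \<delta> \<epsilon>. p ^ cut_value G C) = ?A - ?W"
    by (rule sum_diff [OF finite_cuts [OF G]])
  have "?A - ?W \<le> exp 1 * \<epsilon> * p ^ min_cut_value G"
    using sum_strong_cuts_le [OF G n p eq \<delta> \<epsilon>(1)] split by simp
  also have "\<dots> \<le> \<kappa> * ?A"
    using \<epsilon> pA p by (intro mult_mono) (auto intro: order_trans [of _ "exp 1 * \<epsilon>"])
  finally have W: "?A - ?W \<le> \<kappa> * ?A" .
  have "0 \<le> (\<Sum>C\<in>cuts G - weak_cuts G \<delta> \<epsilon>. p ^ cut_value G C)"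
    using p by (intro sum_nonneg) simp
  then have WA: "?W \<le> ?A" using split by simp
  have A0: "0 \<le> ?A" using F0 FA by linarith
  have "(1 - \<kappa>) * ?A \<le> (1 - (2 * 4 ^ 9 + exp 4) * real (card (verts G)) powr (- 1 / 2)) * ?A"
    using \<kappa>(1) A0 by (intro mult_right_mono) auto
  also have "\<dots> \<le> FAIL G p" by (rule sum_cuts_le_FAIL [OF G n p small])
  finally have F: "?A - \<kappa> * ?A \<le> FAIL G p" by (simp add: left_diff_distrib)
  have \<kappa>0: "0 \<le> \<kappa>" using \<epsilon> by (auto intro: order_trans [of _ "exp 1 * \<epsilon>"])
  have "\<kappa> * ?A \<le> 1 / 2 * ?A" using \<kappa>(2) A0 by (rule mult_right_mono)
  then have "?A \<le> 2 * FAIL G p" using F by linarith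
  then have "\<kappa> * ?A \<le> \<kappa> * (2 * FAIL G p)" using \<kappa>0 by (rule mult_left_mono)
  also have "\<dots> \<le> \<eta> * FAIL G p" using mult_right_mono [OF \<kappa>(3) F0] by (simp add: mult_ac)
  finally have "\<kappa> * ?A \<le> \<eta> * FAIL G p" .
  then show ?thesis using W WA F FA by linarith
qed

theorem theorem5p1:
  fixes \<epsilon> :: "nat \<Rightarrow> real"
  assumes "\<forall>\<^sub>F n in sequentially. 0 < \<epsilon> n"
    and "\<epsilon> \<longlonglongrightarrow> 0"
  shows
    "(\<forall>\<eta>>0. \<forall>\<^sub>F n in sequentially. \<forall>(G :: ('v, 'e) mgraph) (p :: real) (\<delta> :: real).
        multigraph G \<longrightarrow> card (verts G) = n \<longrightarrow> 0 < p \<longrightarrow> p < 1 \<longrightarrow>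
        p ^ min_cut_value G = real n powr (-(2 + \<delta>)) \<longrightarrow>
        p ^ min_cut_value G < real n powr (-4) \<longrightarrow>
        \<bar>(\<Sum>C\<in>weak_cuts G \<delta> (\<epsilon> n). p ^ cut_value G C) - FAIL G p\<bar> \<le> \<eta> * FAIL G p)
     \<and> (\<forall>(G :: ('v, 'e) mgraph) (p :: real).
        multigraph G \<longrightarrow> 2 \<le> card (verts G) \<longrightarrow> 0 < p \<longrightarrow> p < 1 \<longrightarrow>
        FAIL G p < real (card (verts G)) powr (-4) \<longrightarrow>
        p ^ min_cut_value G < real (card (verts G)) powr (-4))"
proof (intro conjI allI impI)
  fix \<eta> :: real
  assume "0 < \<eta>"
  \<comment> \<open>Halving \<open>\<eta>\<close> pays for replacing the sum over all cuts by
    \<open>2 * FAIL G p\<close>.\<close>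
  define \<kappa> where "\<kappa> = min (1 / 2) (\<eta> / 2)"
  have \<kappa>: "0 < \<kappa>" "\<kappa> \<le> 1 / 2" "2 * \<kappa> \<le> \<eta>" using \<open>0 < \<eta>\<close> by (auto simp: \<kappa>_def)
  have "(\<lambda>n. exp 1 * \<epsilon> n) \<longlonglongrightarrow> 0" using tendsto_mult_left [OF assms(2), of "exp 1"] by simp
  then have 1: "\<forall>\<^sub>F n in sequentially. exp 1 * \<epsilon> n < \<kappa>" using \<kappa>(1) by (rule order_tendstoD)
  have "(\<lambda>n. (2 * 4 ^ 9 + exp 4) * real n powr (- 1 / 2)) \<longlonglongrightarrow> 0"
    by (intro tendsto_mult_right_zero tendsto_neg_powr filterlim_real_sequentially) simp
  then have 2: "\<forall>\<^sub>F n in sequentially. (2 * 4 ^ 9 + exp 4) * real n powr (- 1 / 2) < \<kappa>"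
    using \<kappa>(1) by (rule order_tendstoD)
  show "\<forall>\<^sub>F n in sequentially. \<forall>(G :: ('v, 'e) mgraph) (p :: real) (\<delta> :: real).
        multigraph G \<longrightarrow> card (verts G) = n \<longrightarrow> 0 < p \<longrightarrow> p < 1 \<longrightarrow>
        p ^ min_cut_value G = real n powr (-(2 + \<delta>)) \<longrightarrow>
        p ^ min_cut_value G < real n powr (-4) \<longrightarrow>
        \<bar>(\<Sum>C\<in>weak_cuts G \<delta> (\<epsilon> n). p ^ cut_value G C) - FAIL G p\<bar> \<le> \<eta> * FAIL G p"
    \<comment> \<open>These thresholds depend only on \<open>\<eta>\<close> and
      \<open>\<epsilon>\<close>, so the estimate is uniform in \<open>G\<close>, \<open>p\<close>
      and \<open>\<delta>\<close>; two vertices ensure that a cut exists.\<close>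
    using assms(1) 1 2 eventually_ge_at_top [of 2]
  proof eventually_elim
    case (elim n)
    then show ?case
      by (intro allI impI weak_cut_sum_approximates_FAIL [where \<kappa> = \<kappa>]) (use \<kappa> in auto)
  qed
next
  fix G :: "('v, 'e) mgraph" and p :: real
  assume "multigraph G" "2 \<le> card (verts G)" "0 < p" "p < 1" "FAIL G p < real (card (verts G)) powr (-4)"
  then show "p ^ min_cut_value G < real (card (verts G)) powr (-4)"
    using min_cut_failure_le_FAIL by (blast intro: le_less_trans)
qed

end
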